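(* Let $\mathcal{D}\subseteq\mathbb{R}^2$ be a convex compact set, and for every $k\in\mathbb{N}=\{0,1,2,\dots\}$ let $\mathcal{I}_k\subseteq\mathbb{R}^2$ be a non-empty closed convex set (the set of implementable setpoints of an uncertain resource at time step $k$, not known at the time of advertising $\mathcal{A}_k$) which is a projection-translation invariant subset of $\mathcal{D}$. Suppose that, for every $k\ge1$, the resource agent - advertises the $PQ$ profile $\mathcal{A}_k=\mathcal{I}_{k-1}$, and receives a request $u^{\mathrm{req}}_k\in\mathcal{A}_k$; and - implements $u^{\mathrm{imp}}_k=\mathrm{proj}_{\mathcal{I}_k}\bigl(u^{\mathrm{req}}_k-e_{k-1}\bigr)$, where $e_k:=\sum_{i=1}^k(u^{\mathrm{imp}}_i-u^{\mathrm{req}}_i)\in\mathbb{R}^2$ for $k\ge0$ (so $e_0=0$). Then the resource agent has $(\mathrm{diam}\,\mathcal{D})$-bounded accumulated-error, i.e. $\|e_k\|\le\mathrm{diam}\,\mathcal{D}$ for all $k\ge1$.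
   Context: $\|\cdot\|$ is the Euclidean norm; $\mathrm{diam}\,\mathcal{D}=\max\{\|v-w\|:v,w\in\mathcal{D}\}$; $\mathrm{proj}_{\mathcal{I}}(x)$ is the point of $\mathcal{I}$ closest to $x$. Projection-translation invariance: for a convex compact set $\mathcal{D}\subseteq\mathbb{R}^d$, a convex set $\mathcal{I}\subseteq\mathbb{R}^d$ is a projection-translation invariant subset of $\mathcal{D}$ if $\mathcal{I}\subseteq\mathcal{D}$ and for every $v\in\mathcal{D}$ and $u\in\mathcal{I}$ one has $u+v-\mathrm{proj}_{\mathcal{I}}(v)\in\mathcal{D}$. *)

theory Defs
  imports "HOL-Analysis.Analysis"
begin

(* closest_point I v is the projection of v onto I whenever I is non-empty, closed
   and convex. The predicate does not itself require D to be convex and compact and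
   I to be convex; these are separate hypotheses where it is used. *)
definition proj_translation_invariant ::
    "'a::euclidean_space set \<Rightarrow> 'a set \<Rightarrow> bool" where
  "proj_translation_invariant D I \<longleftrightarrow>
     I \<subseteq> D \<and> (\<forall>v\<in>D. \<forall>u\<in>I. u + v - closest_point I v \<in> D)"

(* The sequences are used from time step 1 on; their values at 0 are irrelevant. *)
definition accumulated_error ::
    "(nat \<Rightarrow> 'a::real_normed_vector) \<Rightarrow> (nat \<Rightarrow> 'a) \<Rightarrow> nat \<Rightarrow> 'a" where
  "accumulated_error u_req u_imp k = (\<Sum>i=1..k. u_imp i - u_req i)"

definition bounded_accumulated_error ::
    "real \<Rightarrow> (nat \<Rightarrow> 'a::real_normed_vector) \<Rightarrow> (nat \<Rightarrow> 'a) \<Rightarrow> bool" where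
  "bounded_accumulated_error b u_req u_imp \<longleftrightarrow>
     (\<forall>k\<ge>1. norm (accumulated_error u_req u_imp k) \<le> b)"

end

(* The error is e_k = proj (x_k) - x_k for the shifted request x_k = u_req_k - e_(k-1).
   Hence x_(k+1) = u_req_(k+1) + x_k - proj (x_k) with u_req_(k+1) in I_k, so projection-translation
   invariance keeps every x_k in D, and e_k is a difference of two points of D. *)
theory Submission
  imports Defs
begin

theorem theorem4:
  fixes D :: "(real ^ 2) set"
    and I A :: "nat \<Rightarrow> (real ^ 2) set"
    and u_req u_imp :: "nat \<Rightarrow> real ^ 2"
  assumes "convex D" and "compact D"
    and "\<And>k. I k \<noteq> {}" and "\<And>k. closed (I k)" and "\<And>k. convex (I k)"
    and "\<And>k. proj_translation_invariant D (I k)"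
    and "\<And>k. k \<ge> 1 \<Longrightarrow> A k = I (k - 1)"
    and "\<And>k. k \<ge> 1 \<Longrightarrow> u_req k \<in> A k"
    and "\<And>k. k \<ge> 1 \<Longrightarrow>
           u_imp k = closest_point (I k) (u_req k - accumulated_error u_req u_imp (k - 1))"
  shows "bounded_accumulated_error (diameter D) u_req u_imp"
proof -
  define e where "e = accumulated_error u_req u_imp"
  define x where "x k = u_req k - e (k - 1)" for k
  have sub: "I k \<subseteq> D"
    and inv: "\<And>v u. v \<in> D \<Longrightarrow> u \<in> I k \<Longrightarrow> u + v - closest_point (I k) v \<in> D" for k
    using assms(6)[of k] unfolding proj_translation_invariant_def by blast+
  \<comment> \<open>The index lag matters: the request at \<open>Suc k\<close> lies in the previous
    set \<open>I k\<close>, which is the set the previous step projected onto.\<close>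
  have req: "u_req (Suc k) \<in> I k" for k
    using assms(7,8)[of "Suc k"] by simp
  \<comment> \<open>Split off the last summand: the older error \<open>e k\<close> and the request
    combine to \<open>- x (Suc k)\<close>.\<close>
  have e_Suc: "e (Suc k) = closest_point (I (Suc k)) (x (Suc k)) - x (Suc k)" for k
    using assms(9)[of "Suc k"] by (simp add: e_def x_def accumulated_error_def)
  have x_in: "x (Suc k) \<in> D" for k
  proof (induction k)
    \<comment> \<open>The empty sum \<open>e 0\<close> vanishes, so \<open>x 1\<close> is the first
      request, a point of \<open>I 0\<close>.\<close>
    case 0
    show ?case
      using req[of 0] sub[of 0] by (auto simp: x_def e_def accumulated_error_def)
  next
    case (Suc k)
    \<comment> \<open>\<open>x_def\<close> is instantiated so that \<open>x (Suc k)\<close> stays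
      folded; the right-hand side then matches \<open>inv\<close> for
      \<open>I (Suc k)\<close>.\<close>
    have "x (Suc (Suc k)) = u_req (Suc (Suc k)) + x (Suc k) - closest_point (I (Suc k)) (x (Suc k))"
      by (simp add: x_def[of "Suc (Suc k)"] e_Suc)
    then show ?case
      using inv[OF Suc.IH req[of "Suc k"]] by simp
  qed
  have "norm (e (Suc k)) \<le> diameter D" for k
  proof -
    \<comment> \<open>Closedness and non-emptiness ensure that the closest point is attained in
      \<open>I (Suc k)\<close>.\<close>
    have "closest_point (I (Suc k)) (x (Suc k)) \<in> D"
      using closest_point_in_set[OF assms(4,3)] sub by blast
    then show ?thesis
      using diameter_bounded_bound[OF compact_imp_bounded[OF assms(2)] _ x_in[of k]]
      by (simp add: e_Suc dist_norm)
  qed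
  then show ?thesis
    unfolding bounded_accumulated_error_def e_def
    by (metis Suc_le_D One_nat_def)
qed

end
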